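(* Let $K$ be a field of characteristic zero, let $X$ be a set, and let $H(x)=\langle H_n(x)\rangle_{n\ge 0}$ be a Ward--Horadam functions' sequence of functions $H_n:X\to K$, i.e. $H_0(x)=a(x)$, $H_1(x)=b(x)$ and $H_{n+2}(x)=\sigma(x)H_{n+1}(x)+\tau(x)H_n(x)$ for $n\ge 0$, with $a,b,\sigma,\tau:X\to K$. Suppose that the characteristic equation $z^2-\sigma(x)z-\tau(x)=0$ has roots $p(x),q(x)\in K$ with $p(x)\neq q(x)$, neither of which is a root of unity, so that for all $n\ge 0$ $$H_n(x)=A(x)p(x)^n+B(x)q(x)^n,\qquad A(x)=\frac{b(x)-q(x)a(x)}{p(x)-q(x)},\quad B(x)=-\frac{b(x)-p(x)a(x)}{p(x)-q(x)}.$$ Suppose also that $H_n(x)\neq 0$ for all $n\ge 1$ and all $x\in X$. Let $r,s>0$ be integers and let $h_1(r,s),h_2(r,s):X\to K$ be functions of $x$. Then the recurrence $$\binom{r+s}{r,s}_{H(x)}=h_1(r,s)(x)\,\binom{r+s-1}{r-1,s}_{H(x)}+h_2(r,s)(x)\,\binom{r+s-1}{r,s-1}_{H(x)}$$ (as an identity of functions of $x$, with $\binom{r}{r,0}_{H(x)}=\binom{s}{0,s}_{H(x)}=1$) is equivalent to the identity $$H_{r+s}(x)=h_1(r,s)(x)\,H_r(x)+h_2(r,s)(x)\,H_s(x).$$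
   Context: For a sequence of functions $H(x)=\langle H_n(x)\rangle_{n\ge0}$ with values in a field of characteristic zero and with $H_n(x)\ne 0$ for $n\ge 1$, the $H(x)$-factorial is $H_n(x)!=H_n(x)\cdot H_{n-1}(x)\cdots H_1(x)$ for $n\ge 1$, with $H_0(x)!=1$ (empty product). The $H(x)$-binomial coefficient in multinomial notation is $$\binom{k+l}{k,l}_{H(x)}=\frac{H_{k+l}(x)!}{H_k(x)!\,H_l(x)!}$$ for integers $k,l\ge 0$; in particular $\binom{k}{k,0}_{H(x)}=\binom{l}{0,l}_{H(x)}=1$. *)

theory Defs
  imports Complex_Main
begin

text \<open>
  A sequence of functions \<open>H\<^sub>n : X \<rightarrow> K\<close> is a total function \<open>H :: nat \<Rightarrow> 'x \<Rightarrow> 'k\<close>; only its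
  values on \<open>X\<close> are constrained.
\<close>

definition ward_horadam ::
  "'x set \<Rightarrow> ('x \<Rightarrow> 'k) \<Rightarrow> ('x \<Rightarrow> 'k) \<Rightarrow> ('x \<Rightarrow> 'k) \<Rightarrow> ('x \<Rightarrow> 'k) \<Rightarrow> (nat \<Rightarrow> 'x \<Rightarrow> 'k::field_char_0) \<Rightarrow> bool"
  where "ward_horadam X a b \<sigma> \<tau> H \<longleftrightarrow>
    (\<forall>x\<in>X. H 0 x = a x \<and> H 1 x = b x \<and>
      (\<forall>n. H (n + 2) x = \<sigma> x * H (n + 1) x + \<tau> x * H n x))"

definition root_of_unity :: "'k::field_char_0 \<Rightarrow> bool"
  where "root_of_unity z \<longleftrightarrow> (\<exists>n>0. z ^ n = 1)"

definition H_fact :: "(nat \<Rightarrow> 'x \<Rightarrow> 'k::field_char_0) \<Rightarrow> nat \<Rightarrow> 'x \<Rightarrow> 'k"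
  where "H_fact H n x = (\<Prod>i=1..n. H i x)"

text \<open>Multinomial notation: the upper entry of the symbol is always the sum \<open>k + l\<close> of the lower ones.\<close>

definition H_binomial :: "(nat \<Rightarrow> 'x \<Rightarrow> 'k::field_char_0) \<Rightarrow> nat \<Rightarrow> nat \<Rightarrow> 'x \<Rightarrow> 'k"
  where "H_binomial H k l x = H_fact H (k + l) x / (H_fact H k x * H_fact H l x)"

lemma H_fact_nonzero:
  assumes "\<And>n. n \<ge> 1 \<Longrightarrow> H n x \<noteq> 0"
  shows "H_fact H n x \<noteq> 0"
  using assms by (simp add: H_fact_def)

lemma H_binomial_boundary:
  assumes "\<And>n. n \<ge> 1 \<Longrightarrow> H n x \<noteq> 0"
  shows "H_binomial H k 0 x = 1" and "H_binomial H 0 k x = 1"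
  using H_fact_nonzero[of H x k] assms
  by (simp_all add: H_binomial_def) (simp_all add: H_fact_def)

definition coeff_A :: "('x \<Rightarrow> 'k::field_char_0) \<Rightarrow> ('x \<Rightarrow> 'k) \<Rightarrow> ('x \<Rightarrow> 'k) \<Rightarrow> ('x \<Rightarrow> 'k) \<Rightarrow> 'x \<Rightarrow> 'k"
  where "coeff_A a b p q x = (b x - q x * a x) / (p x - q x)"

definition coeff_B :: "('x \<Rightarrow> 'k::field_char_0) \<Rightarrow> ('x \<Rightarrow> 'k) \<Rightarrow> ('x \<Rightarrow> 'k) \<Rightarrow> ('x \<Rightarrow> 'k) \<Rightarrow> 'x \<Rightarrow> 'k"
  where "coeff_B a b p q x = - ((b x - p x * a x) / (p x - q x))"

text \<open>The Binet form is a consequence of the recurrence, so it need not be assumed separately.\<close>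

lemma ward_horadam_binet:
  assumes H: "ward_horadam X a b \<sigma> \<tau> H" and x: "x \<in> X"
    and p: "(p x)\<^sup>2 - \<sigma> x * p x - \<tau> x = 0"
    and q: "(q x)\<^sup>2 - \<sigma> x * q x - \<tau> x = 0"
    and pq: "p x \<noteq> q x"
  shows "H n x = coeff_A a b p q x * p x ^ n + coeff_B a b p q x * q x ^ n"
proof (induction n rule: less_induct)
  case (less n)
  let ?A = "coeff_A a b p q x" and ?B = "coeff_B a b p q x"
  have d: "p x - q x \<noteq> 0" using pq by simp
  consider "n = 0" | "n = 1" | m where "n = m + 2"
    by (metis One_nat_def Suc_1 add.commute add_2_eq_Suc not0_implies_Suc)
  then show ?case
  proof cases
    case 1
    have "?A + ?B = ((p x - q x) * a x) / (p x - q x)"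
      by (simp add: coeff_A_def coeff_B_def diff_divide_distrib[symmetric] algebra_simps)
    then have "?A + ?B = a x" using d by simp
    with 1 H x show ?thesis by (simp add: ward_horadam_def)
  next
    case 2
    have "?A * p x + ?B * q x = ((p x - q x) * b x) / (p x - q x)"
      by (simp add: coeff_A_def coeff_B_def diff_divide_distrib[symmetric] algebra_simps)
    then have "?A * p x + ?B * q x = b x" using d by simp
    with 2 H x show ?thesis by (simp add: ward_horadam_def)
  next
    case 3
    have P: "p x ^ (m + 2) = \<sigma> x * p x ^ (m + 1) + \<tau> x * p x ^ m"
      using arg_cong[OF p, of "\<lambda>t. t * p x ^ m"] by (simp add: algebra_simps power2_eq_square)
    have Q: "q x ^ (m + 2) = \<sigma> x * q x ^ (m + 1) + \<tau> x * q x ^ m"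
      using arg_cong[OF q, of "\<lambda>t. t * q x ^ m"] by (simp add: algebra_simps power2_eq_square)
    have "H n x = \<sigma> x * H (m + 1) x + \<tau> x * H m x"
      using H x 3 by (simp add: ward_horadam_def)
    also have "\<dots> = ?A * p x ^ (m + 2) + ?B * q x ^ (m + 2)"
      unfolding P Q using less.IH[of m] less.IH[of "m + 1"] 3
      by (simp add: algebra_simps)
    finally show ?thesis using 3 by simp
  qed
qed

end

theory Submission
  imports Defs
begin

text \<open>
  With \<open>C = H\<^sub>r\<^sub>+\<^sub>s\<^sub>-\<^sub>1! / (H\<^sub>r! H\<^sub>s!)\<close>, the three binomial coefficients of the recurrence are
  \<open>C H\<^sub>r\<^sub>+\<^sub>s\<close>, \<open>C H\<^sub>r\<close> and \<open>C H\<^sub>s\<close>: the first has one more factor in its numerator than \<open>C\<close>, and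
  each of the other two has one factor fewer in its denominator. At each point \<open>x\<close>, \<open>C\<close> is built from
  nonzero values of \<open>H\<close>, so the recurrence is the identity for \<open>H\<^sub>r\<^sub>+\<^sub>s\<close> multiplied by a nonzero scalar.
\<close>

lemma H_fact_rec:
  assumes "n > 0"
  shows "H_fact H n x = H n x * H_fact H (n - 1) x"
  using assms by (cases n) (simp_all add: H_fact_def mult.commute)

lemma H_binomial_commute: "H_binomial H k l x = H_binomial H l k x"
  by (simp add: H_binomial_def add.commute mult.commute)

lemma H_binomial_eq_mult_top:
  assumes "r > 0"
  shows "H_binomial H r s x
    = H_fact H (r + s - 1) x / (H_fact H r x * H_fact H s x) * H (r + s) x"
  using assms by (simp add: H_binomial_def H_fact_rec[of "r + s"])

lemma H_binomial_pred_eq_mult: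
  assumes "r > 0" and "H r x \<noteq> 0"
  shows "H_binomial H (r - 1) s x
    = H_fact H (r + s - 1) x / (H_fact H r x * H_fact H s x) * H r x"
  using assms by (simp add: H_binomial_def H_fact_rec[of r])

text \<open>
  At a single point the coefficient functions are just scalars \<open>u\<close> and \<open>v\<close>, so both sides of the
  recurrence are multiples of one nonzero quotient of factorials, which cancels.
\<close>

lemma H_binomial_recurrence_iff:
  fixes H :: "nat \<Rightarrow> 'x \<Rightarrow> 'k::field_char_0"
  assumes nz: "\<And>n. n \<ge> 1 \<Longrightarrow> H n x \<noteq> 0" and "r > 0" and "s > 0"
  shows "H_binomial H r s x = u * H_binomial H (r - 1) s x + v * H_binomial H r (s - 1) x
     \<longleftrightarrow> H (r + s) x = u * H r x + v * H s x"
proof -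
  define C where "C = H_fact H (r + s - 1) x / (H_fact H r x * H_fact H s x)"
  have "C \<noteq> 0"
    using H_fact_nonzero[of H x] nz by (simp add: C_def)
  have top: "H_binomial H r s x = C * H (r + s) x"
    using \<open>r > 0\<close> by (simp add: C_def H_binomial_eq_mult_top)
  have left: "H_binomial H (r - 1) s x = C * H r x"
    unfolding C_def by (rule H_binomial_pred_eq_mult) (use assms in auto)
  have "H_binomial H (s - 1) r x = C * H s x"
    using H_binomial_pred_eq_mult[of s H x r] assms by (simp add: C_def ac_simps)
  then have right: "H_binomial H r (s - 1) x = C * H s x"
    by (simp only: H_binomial_commute[of H r])
  have "u * (C * H r x) + v * (C * H s x) = C * (u * H r x + v * H s x)"
    by (simp add: algebra_simps)
  then show ?thesis
    using \<open>C \<noteq> 0\<close> by (simp only: top left right mult_cancel_left) simp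
qed

theorem theorem2:
  fixes X :: "'x set"
    and H :: "nat \<Rightarrow> 'x \<Rightarrow> 'k::field_char_0"
    and a b \<sigma> \<tau> p q :: "'x \<Rightarrow> 'k"
    and r s :: nat
    and h1 h2 :: "nat \<Rightarrow> nat \<Rightarrow> 'x \<Rightarrow> 'k"
  assumes "ward_horadam X a b \<sigma> \<tau> H"
    and "\<forall>x\<in>X. (p x)\<^sup>2 - \<sigma> x * p x - \<tau> x = 0 \<and> (q x)\<^sup>2 - \<sigma> x * q x - \<tau> x = 0"
    and "\<forall>x\<in>X. p x \<noteq> q x"
    and "\<forall>x\<in>X. \<not> root_of_unity (p x) \<and> \<not> root_of_unity (q x)"
    and "\<forall>n\<ge>1. \<forall>x\<in>X. H n x \<noteq> 0"
    and "r > 0" and "s > 0"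
  shows "(\<forall>x\<in>X. H_binomial H r s x =
              h1 r s x * H_binomial H (r - 1) s x + h2 r s x * H_binomial H r (s - 1) x)
     \<longleftrightarrow> (\<forall>x\<in>X. H (r + s) x = h1 r s x * H r x + h2 r s x * H s x)"
  using assms(5-7) by (intro ball_cong refl H_binomial_recurrence_iff) auto

end
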